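(* If a compactly generated, locally compact Hausdorff group $G$ is equipped with a word metric $d$, then the topological spaces $\mathcal L G$ (the linear boundary) and $\mathcal P G$ (the projective boundary) do not depend on the choice of the word metric (or of the generating set).
   Context: Metric setting. Let $(X,d)$ be a metric space with a fixed reference point $o\in X$ and closed balls $B(x,r)$. For $R\subseteq X$ and $\alpha,a\ge0$ put $\alpha R+a=\bigcup_{x\in R}B(x,\alpha d(o,x)+a)$. For unbounded $R,S\subseteq X$ let $s^+(R,S)$ be the infimum of all $\alpha\ge0$ such that $S\subseteq\alpha R+a$ for some $a\ge0$; put $s(R,S)=\max\{s^+(R,S),s^+(S,R)\}$ and $t(R,S)=\sqrt{s(R,S)}$. Let $\mathcal U$ be the family of unbounded subsets and write $R\sim S$ if $s(R,S)=0$; this is an equivalence relation and $t$ induces a metric on $\mathcal U/{\sim}$. For $\mathcal E\subseteq\mathcal U$ let $\mathcal E/{\sim}\subseteq\mathcal U/{\sim}$ be the set of classes containing an element of $\mathcal E$, and $\mathrm{cl}(\mathcal E/{\sim})$ its closure in $(\mathcal U/{\sim},t)$, with the topology induced by $t$. Groups. If $S=S^{-1}$ is a compact generating set of $G$, the associated word metric is $d(g,h)=\inf\{n\ge0: g^{-1}h\in S^n\}$, where $S^0=\{1\}$ and $S^n$ is the set of products of $n$ elements of $S$. The linear boundary is $\mathcal LG=\mathrm{cl}(\mathcal C^+G/{\sim})$ with $\mathcal C^+G=\{\langle g\rangle^+: g\in G,\ \langle g\rangle^+\text{ unbounded}\}$, $\langle g\rangle^+=\{g^n:n\ge0\}$;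 the projective boundary is $\mathcal PG=\mathrm{cl}(\mathcal CG/{\sim})$ with $\mathcal CG=\{\langle g\rangle: g\in G,\ \langle g\rangle\text{ unbounded}\}$, $\langle g\rangle=\{g^n:n\in\mathbb Z\}$. *)

theory Defs
  imports "HOL-Analysis.Analysis" "HOL-Algebra.Generated_Groups"
begin

section \<open>The space of unbounded subsets of a pointed metric space\<close>

text \<open>
  Throughout, \<open>(X, d)\<close> is a metric space in the sense of \<^locale>\<open>Metric_space\<close> and \<open>p \<in> X\<close> is the
  reference point. \<open>enlarge X d p \<alpha> a R\<close> is the set \<open>\<alpha>R + a\<close>.
\<close>

definition enlarge :: "'a set \<Rightarrow> ('a \<Rightarrow> 'a \<Rightarrow> real) \<Rightarrow> 'a \<Rightarrow> real \<Rightarrow> real \<Rightarrow> 'a set \<Rightarrow> 'a set" where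
  "enlarge X d p \<alpha> a R = (\<Union>x\<in>R. Metric_space.mcball X d x (\<alpha> * d p x + a))"

definition unbounded_sets :: "'a set \<Rightarrow> ('a \<Rightarrow> 'a \<Rightarrow> real) \<Rightarrow> 'a set set" where
  "unbounded_sets X d = {R. R \<subseteq> X \<and> \<not> Metric_space.mbounded X d R}"

text \<open>
  For unbounded \<open>R\<close>, \<open>S\<close> the infimum is over a nonempty set of reals bounded below: if \<open>\<alpha> > 1\<close> then
  every \<open>y \<in> S\<close> satisfies \<open>d x y \<le> \<alpha> * d p x\<close> for all \<open>x \<in> R\<close> far enough from \<open>p\<close>.
\<close>

definition s_plus :: "'a set \<Rightarrow> ('a \<Rightarrow> 'a \<Rightarrow> real) \<Rightarrow> 'a \<Rightarrow> 'a set \<Rightarrow> 'a set \<Rightarrow> real" where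
  "s_plus X d p R S = Inf {\<alpha>. 0 \<le> \<alpha> \<and> (\<exists>a\<ge>0. S \<subseteq> enlarge X d p \<alpha> a R)}"

definition s_dist :: "'a set \<Rightarrow> ('a \<Rightarrow> 'a \<Rightarrow> real) \<Rightarrow> 'a \<Rightarrow> 'a set \<Rightarrow> 'a set \<Rightarrow> real" where
  "s_dist X d p R S = max (s_plus X d p R S) (s_plus X d p S R)"

definition t_dist :: "'a set \<Rightarrow> ('a \<Rightarrow> 'a \<Rightarrow> real) \<Rightarrow> 'a \<Rightarrow> 'a set \<Rightarrow> 'a set \<Rightarrow> real" where
  "t_dist X d p R S = sqrt (s_dist X d p R S)"

definition sim_rel :: "'a set \<Rightarrow> ('a \<Rightarrow> 'a \<Rightarrow> real) \<Rightarrow> 'a \<Rightarrow> ('a set \<times> 'a set) set" where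
  "sim_rel X d p =
     {(R, S). R \<in> unbounded_sets X d \<and> S \<in> unbounded_sets X d \<and> s_dist X d p R S = 0}"

abbreviation unbounded_classes ::
    "'a set \<Rightarrow> ('a \<Rightarrow> 'a \<Rightarrow> real) \<Rightarrow> 'a \<Rightarrow> 'a set set set" where
  "unbounded_classes X d p \<equiv> unbounded_sets X d // sim_rel X d p"

text \<open>
  \<^const>\<open>t_dist\<close> is constant on pairs of classes, so the union below is a singleton. The value \<open>0\<close>
  off the quotient is needed because \<^locale>\<open>Metric_space\<close> asks for nonnegativity on the whole
  type.
\<close>

definition class_dist ::
    "'a set \<Rightarrow> ('a \<Rightarrow> 'a \<Rightarrow> real) \<Rightarrow> 'a \<Rightarrow> 'a set set \<Rightarrow> 'a set set \<Rightarrow> real" where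
  "class_dist X d p A B =
     (if A \<in> unbounded_classes X d p \<and> B \<in> unbounded_classes X d p
      then the_elem (\<Union>R\<in>A. \<Union>S\<in>B. {t_dist X d p R S}) else 0)"

definition class_topology ::
    "'a set \<Rightarrow> ('a \<Rightarrow> 'a \<Rightarrow> real) \<Rightarrow> 'a \<Rightarrow> 'a set set topology" where
  "class_topology X d p = Metric_space.mtopology (unbounded_classes X d p) (class_dist X d p)"

text \<open>
  The space \<open>cl(\<E>/\<sim>)\<close> with the induced topology. For \<open>\<E>\<close> a family of unbounded sets,
  \<open>\<E> // sim_rel X d p\<close> consists of the classes of \<^const>\<open>unbounded_classes\<close> that meet \<open>\<E>\<close>.
\<close>

definition boundary_space ::
    "'a set \<Rightarrow> ('a \<Rightarrow> 'a \<Rightarrow> real) \<Rightarrow> 'a \<Rightarrow> 'a set set \<Rightarrow> 'a set set topology" where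
  "boundary_space X d p \<E> =
     subtopology (class_topology X d p) (class_topology X d p closure_of (\<E> // sim_rel X d p))"


section \<open>Topological groups, word metrics and boundaries\<close>

locale topological_group = group G for G (structure) and T :: "'a topology" +
  assumes topspace_eq_carrier: "topspace T = carrier G"
    and continuous_mult: "continuous_map (prod_topology T T) T (\<lambda>(x, y). x \<otimes> y)"
    and continuous_inv: "continuous_map T T (\<lambda>x. inv x)"

definition compactly_generated :: "('a, 'b) monoid_scheme \<Rightarrow> 'a topology \<Rightarrow> bool" where
  "compactly_generated G T \<longleftrightarrow> (\<exists>K. compactin T K \<and> generate G K = carrier G)"

definition symmetric_compact_generating_set ::
    "('a, 'b) monoid_scheme \<Rightarrow> 'a topology \<Rightarrow> 'a set \<Rightarrow> bool" where
  "symmetric_compact_generating_set G T S \<longleftrightarrow>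
     compactin T S \<and> S = (\<lambda>x. inv\<^bsub>G\<^esub> x) ` S \<and> generate G S = carrier G"

primrec set_power :: "('a, 'b) monoid_scheme \<Rightarrow> 'a set \<Rightarrow> nat \<Rightarrow> 'a set" where
  "set_power G S 0 = {\<one>\<^bsub>G\<^esub>}"
| "set_power G S (Suc n) = set_power G S n <#>\<^bsub>G\<^esub> S"

text \<open>
  The value \<open>0\<close> outside the carrier is needed because \<^locale>\<open>Metric_space\<close> asks for symmetry on
  the whole type.
\<close>

definition word_metric :: "('a, 'b) monoid_scheme \<Rightarrow> 'a set \<Rightarrow> 'a \<Rightarrow> 'a \<Rightarrow> real" where
  "word_metric G S g h =
     (if g \<in> carrier G \<and> h \<in> carrier G
      then real (Inf {n. inv\<^bsub>G\<^esub> g \<otimes>\<^bsub>G\<^esub> h \<in> set_power G S n}) else 0)"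

definition pos_powers :: "('a, 'b) monoid_scheme \<Rightarrow> 'a \<Rightarrow> 'a set" where
  "pos_powers G g = range (\<lambda>n::nat. g [^]\<^bsub>G\<^esub> n)"

definition all_powers :: "('a, 'b) monoid_scheme \<Rightarrow> 'a \<Rightarrow> 'a set" where
  "all_powers G g = range (\<lambda>n::int. g [^]\<^bsub>G\<^esub> n)"

definition linear_boundary ::
    "('a, 'b) monoid_scheme \<Rightarrow> ('a \<Rightarrow> 'a \<Rightarrow> real) \<Rightarrow> 'a \<Rightarrow> 'a set set topology" where
  "linear_boundary G d p =
     boundary_space (carrier G) d p (pos_powers G ` carrier G \<inter> unbounded_sets (carrier G) d)"

definition projective_boundary ::
    "('a, 'b) monoid_scheme \<Rightarrow> ('a \<Rightarrow> 'a \<Rightarrow> real) \<Rightarrow> 'a \<Rightarrow> 'a set set topology" where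
  "projective_boundary G d p =
     boundary_space (carrier G) d p (all_powers G ` carrier G \<inter> unbounded_sets (carrier G) d)"

end

theory Submission
  imports Defs
begin

text \<open>
  Any two word metrics on \<open>G\<close> coming from compact generating sets are bi-Lipschitz equivalent, and
  the boundaries only see the metric up to bi-Lipschitz equivalence.

  For the first point, it suffices that each of two compact symmetric generating sets \<open>S\<close>, \<open>S'\<close> is
  bounded in the word metric of the other. The group is the countable union of the compact, hence
  closed, sets \<open>S\<^sup>n\<close>, and a nonempty locally compact Hausdorff space is not a countable union of
  closed sets with empty interior. So some \<open>S\<^sup>n\<close> has an interior point, and finitely many left
  translates of its interior cover \<open>S'\<close>; each translate \<open>gS\<^sup>n\<close> lies at bounded distance from the
  identity (\<open>compactin_subset_set_powers\<close>).

  For the second point, let the two metrics differ by at most a factor \<open>C\<close>. They have the same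
  unbounded sets, and an inclusion \<open>S \<subseteq> \<alpha>R + a\<close> for one metric gives \<open>S \<subseteq> C\<^sup>2\<alpha>R + Ca\<close> for
  the other. Hence \<open>s\<close> changes at most by the factor \<open>C\<^sup>2\<close> and \<open>t\<close> at most by \<open>C\<close>. In
  particular the relation \<open>s(R,S) = 0\<close>, and with it the set of classes, is literally the same, and
  the two metrics on the set of classes are Lipschitz equivalent and define the same open sets. The
  closures of the same set of classes then agree as subspaces, so that the boundaries are equal and
  not merely homeomorphic (\<open>boundary_space_eq\<close>).

  To speak of open sets on the quotient one needs that \<open>t\<close> induces a metric there. This comes from
  the inequality \<open>1 + s(R,T) \<le> (1 + s(R,S))(1 + s(S,T))\<close> together with \<open>s \<le> 1\<close>
  (\<open>Metric_space_class_dist\<close>).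
\<close>


section \<open>The metric on classes of unbounded sets\<close>

locale pointed_metric_space = Metric_space M d for M :: "'a set" and d +
  fixes p :: 'a
  assumes basepoint: "p \<in> M"
begin

lemma subset_enlarge_iff:
  assumes "R \<subseteq> M" "S \<subseteq> M"
  shows "S \<subseteq> enlarge M d p \<alpha> a R \<longleftrightarrow> (\<forall>y\<in>S. \<exists>x\<in>R. d x y \<le> \<alpha> * d p x + a)"
  using assms by (fastforce simp: enlarge_def)

lemma unbounded_sets_subset: "R \<in> unbounded_sets M d \<Longrightarrow> R \<subseteq> M"
  by (simp add: unbounded_sets_def)

lemma unbounded_sets_far_point:
  assumes "R \<in> unbounded_sets M d"
  obtains x where "x \<in> R" "x \<in> M" "r < d p x"
proof -
  have "\<not> R \<subseteq> mcball p r"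
    using assms mbounded_def by (auto simp: unbounded_sets_def)
  then show thesis
    using that unbounded_sets_subset[OF assms] basepoint by force
qed

text \<open>
  Around a point \<open>x\<close> far away from the base point, a ball of radius \<open>\<alpha> d(p,x)\<close> with \<open>\<alpha> > 1\<close> swallows every
  prescribed point. This makes the infimum defining \<^const>\<open>s_plus\<close> meaningful, and it also
  bounds it by \<open>1\<close>, which the triangle inequality for \<^const>\<open>t_dist\<close> relies on.
\<close>

lemma subset_enlarge_if_gt_1:
  assumes R: "R \<in> unbounded_sets M d" and S: "S \<in> unbounded_sets M d" and "1 < \<alpha>"
  shows "S \<subseteq> enlarge M d p \<alpha> 0 R"
proof -
  have "\<exists>x\<in>R. d x y \<le> \<alpha> * d p x + 0" if "y \<in> S" for y
  proof -
    have y: "y \<in> M"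
      using that S unbounded_sets_subset by blast
    obtain x where x: "x \<in> R" "x \<in> M" "d p y / (\<alpha> - 1) < d p x"
      using R by (rule unbounded_sets_far_point)
    have "d p y < (\<alpha> - 1) * d p x"
      using x(3) \<open>1 < \<alpha>\<close> by (simp add: field_simps)
    moreover have "d x y \<le> d p x + d p y"
      using triangle''[OF x(2) basepoint y] .
    ultimately show ?thesis
      using x(1) by (intro bexI[of _ x]) (auto simp: algebra_simps)
  qed
  then show ?thesis
    unfolding subset_enlarge_iff[OF unbounded_sets_subset[OF R] unbounded_sets_subset[OF S]]
    by blast
qed

lemma s_plus_set_nonempty:
  assumes "R \<in> unbounded_sets M d" "S \<in> unbounded_sets M d"
  shows "{\<alpha>. 0 \<le> \<alpha> \<and> (\<exists>a\<ge>0. S \<subseteq> enlarge M d p \<alpha> a R)} \<noteq> {}"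
proof -
  have "S \<subseteq> enlarge M d p 2 0 R"
    by (intro subset_enlarge_if_gt_1 assms) simp
  then have "(2::real) \<in> {\<alpha>. 0 \<le> \<alpha> \<and> (\<exists>a\<ge>0. S \<subseteq> enlarge M d p \<alpha> a R)}"
    by (intro CollectI conjI exI[of _ 0]) simp_all
  then show ?thesis
    by blast
qed

lemma s_plus_le:
  assumes "0 \<le> \<alpha>" "0 \<le> a" "S \<subseteq> enlarge M d p \<alpha> a R"
  shows "s_plus M d p R S \<le> \<alpha>"
  unfolding s_plus_def using assms by (intro cInf_lower bdd_belowI[of _ 0]) auto

lemma s_plus_le_1:
  assumes "R \<in> unbounded_sets M d" "S \<in> unbounded_sets M d"
  shows "s_plus M d p R S \<le> 1"
proof (rule dense_ge)
  fix \<alpha> :: real assume "1 < \<alpha>"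
  then show "s_plus M d p R S \<le> \<alpha>"
    by (intro s_plus_le[of \<alpha> 0] subset_enlarge_if_gt_1 assms) auto
qed

lemma s_plus_nonneg:
  assumes "R \<in> unbounded_sets M d" "S \<in> unbounded_sets M d"
  shows "0 \<le> s_plus M d p R S"
  unfolding s_plus_def
proof (rule cInf_greatest)
  show "{\<alpha>. 0 \<le> \<alpha> \<and> (\<exists>a\<ge>0. S \<subseteq> enlarge M d p \<alpha> a R)} \<noteq> {}"
    using assms by (rule s_plus_set_nonempty)
qed auto

lemma s_plus_lessE:
  assumes R: "R \<in> unbounded_sets M d" and S: "S \<in> unbounded_sets M d"
    and "s_plus M d p R S < \<alpha>"
  obtains a where "0 \<le> a" "\<And>y. y \<in> S \<Longrightarrow> \<exists>x\<in>R. d x y \<le> \<alpha> * d p x + a"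
proof -
  have "\<exists>\<beta>\<in>{\<alpha>. 0 \<le> \<alpha> \<and> (\<exists>a\<ge>0. S \<subseteq> enlarge M d p \<alpha> a R)}. \<beta> < \<alpha>"
  proof (rule cInf_lessD)
    show "{\<alpha>. 0 \<le> \<alpha> \<and> (\<exists>a\<ge>0. S \<subseteq> enlarge M d p \<alpha> a R)} \<noteq> {}"
      using R S by (rule s_plus_set_nonempty)
    show "Inf {\<alpha>. 0 \<le> \<alpha> \<and> (\<exists>a\<ge>0. S \<subseteq> enlarge M d p \<alpha> a R)} < \<alpha>"
      using assms(3) by (simp only: s_plus_def)
  qed
  then obtain \<beta> a where \<beta>: "0 \<le> \<beta>" "\<beta> < \<alpha>" "0 \<le> a" "S \<subseteq> enlarge M d p \<beta> a R"
    by (elim bexE CollectE conjE exE) (rule that)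
  have near: "\<forall>y\<in>S. \<exists>x\<in>R. d x y \<le> \<beta> * d p x + a"
    using \<beta>(4) subset_enlarge_iff[OF R[THEN unbounded_sets_subset] S[THEN unbounded_sets_subset]]
    by (rule iffD1[rotated])
  have *: "\<exists>x\<in>R. d x y \<le> \<alpha> * d p x + a" if y: "y \<in> S" for y
  proof -
    obtain x where "x \<in> R" "d x y \<le> \<beta> * d p x + a"
      using bspec[OF near y] ..
    moreover have "\<beta> * d p x \<le> \<alpha> * d p x"
      using \<beta> by (intro mult_right_mono) auto
    ultimately show ?thesis
      by (intro bexI[of _ x]) auto
  qed
  show thesis
    using \<beta>(3) * by (rule that)
qed

lemma s_plus_refl:
  assumes "R \<in> unbounded_sets M d"
  shows "s_plus M d p R R = 0"
proof -
  have "R \<subseteq> enlarge M d p 0 0 R"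
  proof
    fix x assume "x \<in> R"
    then show "x \<in> enlarge M d p 0 0 R"
      using unbounded_sets_subset[OF assms] by (auto simp: enlarge_def intro!: bexI[of _ x])
  qed
  then have "s_plus M d p R R \<le> 0"
    by (intro s_plus_le[of 0 0]) auto
  then show ?thesis
    using s_plus_nonneg[OF assms assms] by simp
qed

text \<open>
  Chaining an \<open>\<alpha>\<close>-enlargement with a \<open>\<beta>\<close>-enlargement gives the factor
  \<open>\<alpha> + \<beta> + \<alpha>\<beta>\<close>, because the second radius is measured at a point whose distance from the base
  point has itself grown by the factor \<open>1 + \<alpha>\<close>. Hence \<open>1 + s\<^sup>+\<close> is submultiplicative.
\<close>

lemma s_plus_submultiplicative:
  assumes R: "R \<in> unbounded_sets M d" and S: "S \<in> unbounded_sets M d"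
    and T: "T \<in> unbounded_sets M d"
  shows "1 + s_plus M d p R T \<le> (1 + s_plus M d p R S) * (1 + s_plus M d p S T)"
proof -
  have *: "1 + s_plus M d p R T \<le> (1 + \<alpha>) * (1 + \<beta>)"
    if \<alpha>: "s_plus M d p R S < \<alpha>" and \<beta>: "s_plus M d p S T < \<beta>" for \<alpha> \<beta>
  proof -
    have pos: "0 < \<alpha>" "0 < \<beta>"
      using \<alpha> \<beta> s_plus_nonneg[OF R S] s_plus_nonneg[OF S T] by auto
    obtain a where a: "0 \<le> a" "\<And>y. y \<in> S \<Longrightarrow> \<exists>x\<in>R. d x y \<le> \<alpha> * d p x + a"
      using s_plus_lessE[OF R S \<alpha>] by blast
    obtain b where b: "0 \<le> b" "\<And>z. z \<in> T \<Longrightarrow> \<exists>y\<in>S. d y z \<le> \<beta> * d p y + b"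
      using s_plus_lessE[OF S T \<beta>] by blast
    have "\<exists>x\<in>R. d x z \<le> (\<alpha> + \<beta> + \<alpha> * \<beta>) * d p x + (a + b + \<beta> * a)" if z: "z \<in> T" for z
    proof -
      obtain y where y: "y \<in> S" "d y z \<le> \<beta> * d p y + b"
        using b z by blast
      obtain x where x: "x \<in> R" "d x y \<le> \<alpha> * d p x + a"
        using a y by blast
      have M: "x \<in> M" "y \<in> M" "z \<in> M"
        using x y z R S T unbounded_sets_subset by blast+
      have "d p y \<le> d p x + (\<alpha> * d p x + a)"
        using triangle[OF basepoint M(1,2)] x by simp
      then have "\<beta> * d p y \<le> \<beta> * (d p x + (\<alpha> * d p x + a))"
        using pos by (intro mult_left_mono) auto
      then have "d x z \<le> (\<alpha> * d p x + a) + (\<beta> * (d p x + (\<alpha> * d p x + a)) + b)"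
        using triangle[OF M] x y by linarith
      then show ?thesis
        using x(1) by (intro bexI[of _ x]) (auto simp: algebra_simps)
    qed
    then have "T \<subseteq> enlarge M d p (\<alpha> + \<beta> + \<alpha> * \<beta>) (a + b + \<beta> * a) R"
      unfolding subset_enlarge_iff[OF unbounded_sets_subset[OF R] unbounded_sets_subset[OF T]]
      by blast
    then have "s_plus M d p R T \<le> \<alpha> + \<beta> + \<alpha> * \<beta>"
      using pos a b by (intro s_plus_le) auto
    then show ?thesis
      by (simp add: algebra_simps)
  qed
  have pos: "0 < 1 + s_plus M d p R S" "0 < 1 + s_plus M d p S T"
    using s_plus_nonneg[OF R S] s_plus_nonneg[OF S T] by auto
  have **: "1 + s_plus M d p R T \<le> (1 + s_plus M d p R S) * (1 + \<beta>)"
    if \<beta>: "s_plus M d p S T < \<beta>" for \<beta>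
  proof -
    have \<beta>': "0 < 1 + \<beta>"
      using \<beta> pos by linarith
    have "(1 + s_plus M d p R T) / (1 + \<beta>) - 1 \<le> s_plus M d p R S"
    proof (rule dense_ge)
      fix \<alpha> assume "s_plus M d p R S < \<alpha>"
      then show "(1 + s_plus M d p R T) / (1 + \<beta>) - 1 \<le> \<alpha>"
        using *[OF _ \<beta>, of \<alpha>] \<beta>' by (simp add: field_simps)
    qed
    then show ?thesis
      using \<beta>' by (simp add: field_simps)
  qed
  have "(1 + s_plus M d p R T) / (1 + s_plus M d p R S) - 1 \<le> s_plus M d p S T"
  proof (rule dense_ge)
    fix \<beta> assume "s_plus M d p S T < \<beta>"
    then show "(1 + s_plus M d p R T) / (1 + s_plus M d p R S) - 1 \<le> \<beta>"
      using **[of \<beta>] pos by (simp add: field_simps)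
  qed
  then show ?thesis
    using pos by (simp add: field_simps)
qed

lemma s_dist_commute: "s_dist M d p R S = s_dist M d p S R"
  by (simp add: s_dist_def max.commute)

lemma s_dist_nonneg:
  "R \<in> unbounded_sets M d \<Longrightarrow> S \<in> unbounded_sets M d \<Longrightarrow> 0 \<le> s_dist M d p R S"
  by (simp add: s_dist_def le_max_iff_disj s_plus_nonneg)

lemma s_dist_le_1:
  "R \<in> unbounded_sets M d \<Longrightarrow> S \<in> unbounded_sets M d \<Longrightarrow> s_dist M d p R S \<le> 1"
  by (simp add: s_dist_def s_plus_le_1)

lemma s_dist_refl: "R \<in> unbounded_sets M d \<Longrightarrow> s_dist M d p R R = 0"
  by (simp add: s_dist_def s_plus_refl)

lemma s_dist_submultiplicative:
  assumes R: "R \<in> unbounded_sets M d" and S: "S \<in> unbounded_sets M d"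
    and T: "T \<in> unbounded_sets M d"
  shows "1 + s_dist M d p R T \<le> (1 + s_dist M d p R S) * (1 + s_dist M d p S T)"
proof -
  have "(1 + s_plus M d p R S) * (1 + s_plus M d p S T)
      \<le> (1 + s_dist M d p R S) * (1 + s_dist M d p S T)"
    using s_plus_nonneg[OF R S] s_plus_nonneg[OF S T]
    by (intro mult_mono) (auto simp: s_dist_def)
  moreover have "(1 + s_plus M d p T S) * (1 + s_plus M d p S R)
      \<le> (1 + s_dist M d p S T) * (1 + s_dist M d p R S)"
    using s_plus_nonneg[OF S R] s_plus_nonneg[OF T S]
    by (intro mult_mono) (auto simp: s_dist_def)
  ultimately show ?thesis
    using s_plus_submultiplicative[OF R S T] s_plus_submultiplicative[OF T S R]
    by (simp add: s_dist_def[of M d p R T] mult.commute max_def)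
qed

text \<open>
  Here the square root in \<^const>\<open>t_dist\<close> pays off. From \<open>s(R,T) \<le> u + v + uv\<close> with \<open>u = s(R,S)\<close>, \<open>v = s(S,T)\<close> one gets
  \<open>\<surd>s(R,T) \<le> \<surd>u + \<surd>v\<close>, since \<open>uv \<le> 2\<surd>u\<surd>v\<close> as long as \<open>u, v \<le> 1\<close>.
\<close>

lemma t_dist_triangle:
  assumes R: "R \<in> unbounded_sets M d" and S: "S \<in> unbounded_sets M d"
    and T: "T \<in> unbounded_sets M d"
  shows "t_dist M d p R T \<le> t_dist M d p R S + t_dist M d p S T"
proof -
  define u v where "u = sqrt (s_dist M d p R S)" and "v = sqrt (s_dist M d p S T)"
  have u: "0 \<le> u" "u \<le> 1" "s_dist M d p R S = u\<^sup>2"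
    and v: "0 \<le> v" "v \<le> 1" "s_dist M d p S T = v\<^sup>2"
    using s_dist_nonneg s_dist_le_1 R S T by (auto simp: u_def v_def)
  have "s_dist M d p R T \<le> u\<^sup>2 + v\<^sup>2 + (u * v) * (u * v)"
    using s_dist_submultiplicative[OF R S T] u v by (simp add: algebra_simps power2_eq_square)
  also have "(u * v) * (u * v) \<le> 1 * (u * v)"
    using u v by (intro mult_right_mono mult_le_one) auto
  also have "u\<^sup>2 + v\<^sup>2 + 1 * (u * v) \<le> (u + v)\<^sup>2"
    using u v by (simp add: power2_sum)
  finally show ?thesis
    unfolding t_dist_def u_def[symmetric] v_def[symmetric]
    using u(1) v(1) by (intro real_le_lsqrt) auto
qed

lemma t_dist_commute: "t_dist M d p R S = t_dist M d p S R"
  by (simp add: t_dist_def s_dist_commute)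

lemma t_dist_nonneg:
  "R \<in> unbounded_sets M d \<Longrightarrow> S \<in> unbounded_sets M d \<Longrightarrow> 0 \<le> t_dist M d p R S"
  by (simp add: t_dist_def s_dist_nonneg)

lemma sim_rel_iff:
  "(R, S) \<in> sim_rel M d p \<longleftrightarrow>
     R \<in> unbounded_sets M d \<and> S \<in> unbounded_sets M d \<and> t_dist M d p R S = 0"
  by (simp add: sim_rel_def t_dist_def)

lemma equiv_sim_rel: "equiv (unbounded_sets M d) (sim_rel M d p)"
proof (rule equivI)
  show "refl_on (unbounded_sets M d) (sim_rel M d p)"
    by (auto simp: refl_on_def sim_rel_def s_dist_refl)
  show "sym (sim_rel M d p)"
    by (auto simp: sym_def sim_rel_def s_dist_commute)
  show "trans (sim_rel M d p)"
  proof (rule transI)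
    fix R S T assume "(R, S) \<in> sim_rel M d p" "(S, T) \<in> sim_rel M d p"
    then show "(R, T) \<in> sim_rel M d p"
      using t_dist_triangle[of R S T] t_dist_nonneg[of R T] by (auto simp: sim_rel_iff)
  qed
qed (auto simp: sim_rel_def)

lemma t_dist_cong:
  assumes "(R, R') \<in> sim_rel M d p" "(S, S') \<in> sim_rel M d p"
  shows "t_dist M d p R S = t_dist M d p R' S'"
proof -
  have RS: "R \<in> unbounded_sets M d" "R' \<in> unbounded_sets M d" "t_dist M d p R R' = 0"
    "S \<in> unbounded_sets M d" "S' \<in> unbounded_sets M d" "t_dist M d p S S' = 0"
    using assms by (auto simp: sim_rel_iff)
  show ?thesis
    using t_dist_triangle[OF RS(1,2,4)] t_dist_triangle[OF RS(2,5,4)]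
      t_dist_triangle[OF RS(2,1,5)] t_dist_triangle[OF RS(1,4,5)]
      RS(3,6) t_dist_commute[of R' R] t_dist_commute[of S' S]
    by linarith
qed

lemma classE:
  assumes "A \<in> unbounded_classes M d p"
  obtains R where "R \<in> unbounded_sets M d" "A = sim_rel M d p `` {R}" "R \<in> A"
  using assms
proof (rule quotientE)
  fix R assume "A = sim_rel M d p `` {R}" "R \<in> unbounded_sets M d"
  then show thesis
    using that equiv_class_self[OF equiv_sim_rel, of R] by simp
qed

lemma class_dist_eq_t_dist:
  assumes A: "A \<in> unbounded_classes M d p" and B: "B \<in> unbounded_classes M d p"
    and "R \<in> A" "S \<in> B"
  shows "class_dist M d p A B = t_dist M d p R S"
proof -
  have "{t_dist M d p R' S'} = {t_dist M d p R S}" if "R' \<in> A" "S' \<in> B" for R' S'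
    using that assms
    by (intro arg_cong[of _ _ "\<lambda>x. {x}"] t_dist_cong in_quotient_imp_in_rel[OF equiv_sim_rel, of A]
        in_quotient_imp_in_rel[OF equiv_sim_rel, of B]) auto
  then have "(\<Union>R'\<in>A. \<Union>S'\<in>B. {t_dist M d p R' S'}) = (\<Union>R'\<in>A. \<Union>S'\<in>B. {t_dist M d p R S})"
    by (intro SUP_cong refl)
  also have "\<dots> = {t_dist M d p R S}"
    using assms(3,4) by blast
  finally have "(\<Union>R'\<in>A. \<Union>S'\<in>B. {t_dist M d p R' S'}) = {t_dist M d p R S}" .
  then show ?thesis
    using A B by (simp add: class_dist_def)
qed

lemma Metric_space_class_dist: "Metric_space (unbounded_classes M d p) (class_dist M d p)"
proof
  show "0 \<le> class_dist M d p A B" for A B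
  proof (cases "A \<in> unbounded_classes M d p \<and> B \<in> unbounded_classes M d p")
    case True
    then show ?thesis
      by (metis classE class_dist_eq_t_dist t_dist_nonneg)
  qed (auto simp: class_dist_def)
  show "class_dist M d p A B = class_dist M d p B A" for A B
  proof (cases "A \<in> unbounded_classes M d p \<and> B \<in> unbounded_classes M d p")
    case True
    then show ?thesis
      by (metis classE class_dist_eq_t_dist t_dist_commute)
  qed (auto simp: class_dist_def)
  fix A B
  assume AB: "A \<in> unbounded_classes M d p" "B \<in> unbounded_classes M d p"
  obtain R where R: "R \<in> unbounded_sets M d" "A = sim_rel M d p `` {R}" "R \<in> A"
    using AB(1) by (rule classE)
  obtain S where S: "S \<in> unbounded_sets M d" "B = sim_rel M d p `` {S}" "S \<in> B"
    using AB(2) by (rule classE)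
  have "class_dist M d p A B = t_dist M d p R S"
    using AB R S class_dist_eq_t_dist by blast
  then show "class_dist M d p A B = 0 \<longleftrightarrow> A = B"
    using R S equiv_class_eq_iff[OF equiv_sim_rel, of R S] by (simp add: sim_rel_iff)
  fix C
  assume C: "C \<in> unbounded_classes M d p"
  obtain T where T: "T \<in> unbounded_sets M d" "C = sim_rel M d p `` {T}" "T \<in> C"
    using C by (rule classE)
  show "class_dist M d p A C \<le> class_dist M d p A B + class_dist M d p B C"
    using AB C R S T class_dist_eq_t_dist t_dist_triangle by simp
qed

end


section \<open>Bi-Lipschitz changes of the metric\<close>

text \<open>
  The hypotheses are symmetric in \<open>d\<close> and \<open>d'\<close>, with one constant for both directions, so each
  one-sided estimate below yields its converse through \<open>swap\<close>.
\<close>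

locale bilipschitz_metrics =
  m: pointed_metric_space M d p + m': pointed_metric_space M d' p for M :: "'a set" and d d' p +
  fixes C :: real
  assumes C_pos: "0 < C"
    and le: "\<And>x y. x \<in> M \<Longrightarrow> y \<in> M \<Longrightarrow> d' x y \<le> C * d x y"
    and ge: "\<And>x y. x \<in> M \<Longrightarrow> y \<in> M \<Longrightarrow> d x y \<le> C * d' x y"
begin

lemma swap: "bilipschitz_metrics M d' d p C"
  using C_pos le ge by unfold_locales auto

lemma mbounded_imp:
  assumes "m.mbounded R"
  shows "m'.mbounded R"
proof -
  obtain B where R: "R \<subseteq> M" and B: "\<And>x y. x \<in> R \<Longrightarrow> y \<in> R \<Longrightarrow> d x y \<le> B"
    using assms m.mbounded_alt by meson
  have "d' x y \<le> C * B" if xy: "x \<in> R" "y \<in> R" for x y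
  proof -
    have "x \<in> M" "y \<in> M"
      using R xy by auto
    then have "d' x y \<le> C * d x y"
      by (rule le)
    also have "\<dots> \<le> C * B"
      using B[OF xy] C_pos by simp
    finally show ?thesis .
  qed
  then show ?thesis
    using R m'.mbounded_alt by blast
qed

lemma unbounded_sets_eq: "unbounded_sets M d' = unbounded_sets M d"
proof -
  have "m'.mbounded R \<longleftrightarrow> m.mbounded R" for R
    using bilipschitz_metrics.mbounded_imp[OF swap, of R] mbounded_imp[of R] by (rule iffI)
  then show ?thesis
    by (simp add: unbounded_sets_def)
qed

text \<open>
  Both the radius \<open>\<alpha> d(p,x) + a\<close> and the distance it is compared with change by at most a factor
  \<open>C\<close>, so \<open>\<alpha>\<close> changes by at most \<open>C\<^sup>2\<close>.
\<close>

lemma s_plus_bilipschitz_le: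
  assumes R: "R \<in> unbounded_sets M d" and S: "S \<in> unbounded_sets M d"
  shows "s_plus M d' p R S \<le> C\<^sup>2 * s_plus M d p R S"
proof -
  have C2: "0 < C\<^sup>2"
    using C_pos by simp
  have "s_plus M d' p R S / C\<^sup>2 \<le> s_plus M d p R S"
  proof (rule dense_ge)
    fix \<alpha> assume \<alpha>: "s_plus M d p R S < \<alpha>"
    then have "0 < \<alpha>"
      using m.s_plus_nonneg[OF R S] by simp
    obtain a where a: "0 \<le> a" "\<And>y. y \<in> S \<Longrightarrow> \<exists>x\<in>R. d x y \<le> \<alpha> * d p x + a"
      using m.s_plus_lessE[OF R S \<alpha>] by blast
    have "\<exists>x\<in>R. d' x y \<le> (C\<^sup>2 * \<alpha>) * d' p x + C * a" if y: "y \<in> S" for y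
    proof -
      obtain x where x: "x \<in> R" "d x y \<le> \<alpha> * d p x + a"
        using a y by blast
      have M: "x \<in> M" "y \<in> M"
        using x y R S m.unbounded_sets_subset by blast+
      have "d' x y \<le> C * d x y"
        using le M by blast
      also have "\<dots> \<le> C * (\<alpha> * d p x + a)"
        using x C_pos by simp
      also have "\<dots> \<le> C * (\<alpha> * (C * d' p x) + a)"
        using ge[OF m.basepoint M(1)] C_pos \<open>0 < \<alpha>\<close> by simp
      finally show ?thesis
        using x(1) by (intro bexI[of _ x]) (auto simp: algebra_simps power2_eq_square)
    qed
    then have "S \<subseteq> enlarge M d' p (C\<^sup>2 * \<alpha>) (C * a) R"
      using R S
      by (subst m'.subset_enlarge_iff) (blast dest: m.unbounded_sets_subset)+
    then have "s_plus M d' p R S \<le> C\<^sup>2 * \<alpha>"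
      using C_pos \<open>0 < \<alpha>\<close> a by (intro m'.s_plus_le) auto
    then show "s_plus M d' p R S / C\<^sup>2 \<le> \<alpha>"
      using C2 by (simp add: field_simps)
  qed
  then show ?thesis
    using C2 by (simp add: field_simps)
qed

lemma t_dist_bilipschitz_le:
  assumes R: "R \<in> unbounded_sets M d" and S: "S \<in> unbounded_sets M d"
  shows "t_dist M d' p R S \<le> C * t_dist M d p R S"
proof -
  have "C\<^sup>2 * s_plus M d p R S \<le> C\<^sup>2 * s_dist M d p R S"
    "C\<^sup>2 * s_plus M d p S R \<le> C\<^sup>2 * s_dist M d p R S"
    by (intro mult_left_mono; simp add: s_dist_def)+
  then have "s_dist M d' p R S \<le> C\<^sup>2 * s_dist M d p R S"
    using s_plus_bilipschitz_le[OF R S] s_plus_bilipschitz_le[OF S R]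
    by (simp add: s_dist_def[of M d'])
  then have "sqrt (s_dist M d' p R S) \<le> sqrt (C\<^sup>2 * s_dist M d p R S)"
    by simp
  then show ?thesis
    using C_pos by (simp add: t_dist_def real_sqrt_mult)
qed

lemma sim_rel_subset: "sim_rel M d p \<subseteq> sim_rel M d' p"
proof clarify
  fix R S assume "(R, S) \<in> sim_rel M d p"
  then show "(R, S) \<in> sim_rel M d' p"
    using t_dist_bilipschitz_le[of R S] m'.t_dist_nonneg[of R S] unbounded_sets_eq
    by (auto simp: m.sim_rel_iff m'.sim_rel_iff)
qed

lemma sim_rel_eq: "sim_rel M d' p = sim_rel M d p"
  using sim_rel_subset bilipschitz_metrics.sim_rel_subset[OF swap] by blast

lemma unbounded_classes_eq: "unbounded_classes M d' p = unbounded_classes M d p"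
  by (simp add: unbounded_sets_eq sim_rel_eq)

text \<open>
  As \<^const>\<open>class_dist\<close> grows at most by the factor \<open>C\<close>, every \<open>d'\<close>-ball of radius \<open>r\<close> contains the
  \<open>d\<close>-ball of radius \<open>r/C\<close> with the same centre.
\<close>

lemma openin_class_topology_mono:
  assumes "openin (class_topology M d' p) U"
  shows "openin (class_topology M d p) U"
proof -
  interpret c: Metric_space "unbounded_classes M d p" "class_dist M d p"
    by (rule m.Metric_space_class_dist)
  interpret c': Metric_space "unbounded_classes M d p" "class_dist M d' p"
    using m'.Metric_space_class_dist by (simp add: unbounded_classes_eq)
  have dist_le: "class_dist M d' p A B \<le> C * class_dist M d p A B"
    if AB: "A \<in> unbounded_classes M d p" "B \<in> unbounded_classes M d p" for A B
  proof -
    obtain R where R: "R \<in> unbounded_sets M d" "R \<in> A"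
      using AB(1) by (rule m.classE)
    obtain S where S: "S \<in> unbounded_sets M d" "S \<in> B"
      using AB(2) by (rule m.classE)
    show ?thesis
      using t_dist_bilipschitz_le[OF R(1) S(1)] AB R(2) S(2)
      by (simp add: m.class_dist_eq_t_dist m'.class_dist_eq_t_dist unbounded_classes_eq)
  qed
  have U: "openin c'.mtopology U"
    using assms by (simp add: class_topology_def unbounded_classes_eq)
  have "openin c.mtopology U"
    unfolding c.openin_mtopology
  proof (intro conjI allI impI)
    show "U \<subseteq> unbounded_classes M d p"
      using U c'.openin_mtopology by blast
    fix A assume "A \<in> U"
    then obtain r where r: "0 < r" "c'.mball A r \<subseteq> U"
      using U c'.openin_mtopology by blast
    have "c.mball A (r / C) \<subseteq> c'.mball A r"
    proof
      fix B assume B: "B \<in> c.mball A (r / C)"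
      then have "C * class_dist M d p A B < r"
        using C_pos by (simp add: field_simps)
      then show "B \<in> c'.mball A r"
        using B dist_le[of A B] by auto
    qed
    then show "\<exists>r>0. c.mball A r \<subseteq> U"
      using r C_pos by (intro exI[of _ "r / C"]) auto
  qed
  then show ?thesis
    by (simp add: class_topology_def)
qed

lemma class_topology_eq: "class_topology M d' p = class_topology M d p"
  unfolding topology_eq
proof (intro allI iffI)
  fix U
  show "openin (class_topology M d p) U" if "openin (class_topology M d' p) U"
    using that by (rule openin_class_topology_mono)
  show "openin (class_topology M d' p) U" if "openin (class_topology M d p) U"
    using that by (rule bilipschitz_metrics.openin_class_topology_mono[OF swap])
qed

lemma boundary_space_eq: "boundary_space M d' p \<E> = boundary_space M d p \<E>"
  by (simp add: boundary_space_def class_topology_eq sim_rel_eq)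

end


section \<open>Word metrics\<close>

context group
begin

lemma set_power_closed: "S \<subseteq> carrier G \<Longrightarrow> set_power G S n \<subseteq> carrier G"
  by (induction n) (auto simp: set_mult_closed)

lemma set_power_1:
  assumes "S \<subseteq> carrier G"
  shows "set_power G S 1 = S"
proof -
  have "\<one> \<otimes> x = x" if "x \<in> S" for x
    using assms that by (intro l_one) auto
  then show ?thesis
    by (auto simp: set_mult_def)
qed

lemma mult_in_set_power_add:
  assumes S: "S \<subseteq> carrier G" and g: "g \<in> set_power G S m" and "h \<in> set_power G S n"
  shows "g \<otimes> h \<in> set_power G S (m + n)"
  using assms(3)
proof (induction n arbitrary: h)
  case 0
  moreover have "g \<in> carrier G"
    using g set_power_closed[OF S] by blast
  ultimately show ?case
    using g by simp
next
  case (Suc n)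
  then obtain h' s where h': "h' \<in> set_power G S n" "s \<in> S" "h = h' \<otimes> s"
    by (auto simp: set_mult_def)
  moreover have "g \<in> carrier G" "h' \<in> carrier G" "s \<in> carrier G"
    using g h' S set_power_closed[OF S] by blast+
  ultimately have "g \<otimes> h = (g \<otimes> h') \<otimes> s"
    by (simp add: m_assoc)
  then show ?case
    using Suc.IH h' by (auto simp: set_mult_def)
qed

lemma inv_in_set_power:
  assumes S: "S \<subseteq> carrier G" and sym: "S = (\<lambda>x. inv x) ` S" and "g \<in> set_power G S n"
  shows "inv g \<in> set_power G S n"
  using assms(3)
proof (induction n arbitrary: g)
  case (Suc n)
  then obtain h s where h: "h \<in> set_power G S n" "s \<in> S" "g = h \<otimes> s"
    by (auto simp: set_mult_def)
  have "inv s \<in> set_power G S 1"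
    using h(2) sym set_power_1[OF S] by blast
  then have "inv s \<otimes> inv h \<in> set_power G S (1 + n)"
    using mult_in_set_power_add[OF S] Suc.IH h(1) by blast
  moreover have "inv g = inv s \<otimes> inv h"
    using h S set_power_closed[OF S] by (simp add: inv_mult_group subset_iff)
  ultimately show ?case
    by simp
qed auto

text \<open>
  Symmetry of \<open>S\<close> makes inverses of generators words of length one, so every element has a finite
  word length.
\<close>

lemma generate_subset_set_powers:
  assumes S: "S \<subseteq> carrier G" and sym: "S = (\<lambda>x. inv x) ` S"
  shows "generate G S \<subseteq> (\<Union>n. set_power G S n)"
proof
  fix g assume "g \<in> generate G S"
  then show "g \<in> (\<Union>n. set_power G S n)"
  proof induction
    case one
    then show ?case
      by (intro UN_I[of 0]) auto
  next
    case (incl h)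
    then show ?case
      using set_power_1[OF S] by blast
  next
    case (inv h)
    then show ?case
      using set_power_1[OF S] sym by blast
  next
    case (eng h1 h2)
    then show ?case
      using mult_in_set_power_add[OF S] by blast
  qed
qed

text \<open>
  If every letter of \<open>S'\<close> is a word of length at most \<open>N\<close> over \<open>S\<close>, substituting these words
  stretches lengths by at most the factor \<open>N\<close>.
\<close>

lemma set_power_subset_balls:
  assumes S: "S \<subseteq> carrier G" and S': "S' \<subseteq> (\<Union>k\<le>N. set_power G S k)"
  shows "set_power G S' n \<subseteq> (\<Union>k\<le>N * n. set_power G S k)"
proof (induction n)
  case (Suc n)
  show ?case
  proof
    fix g assume "g \<in> set_power G S' (Suc n)"
    then obtain h s where hs: "h \<in> set_power G S' n" "s \<in> S'" "g = h \<otimes> s"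
      by (auto simp: set_mult_def)
    obtain k where k: "k \<le> N * n" "h \<in> set_power G S k"
      using Suc.IH hs(1) by blast
    obtain l where l: "l \<le> N" "s \<in> set_power G S l"
      using S' hs(2) by blast
    have "g \<in> set_power G S (k + l)"
      using mult_in_set_power_add[OF S] hs k l by blast
    moreover have "k + l \<le> N * Suc n"
      using k l by simp
    ultimately show "g \<in> (\<Union>k\<le>N * Suc n. set_power G S k)"
      by blast
  qed
qed auto

end

locale symmetric_generating_set = group G for G (structure) +
  fixes S :: "'a set"
  assumes subset: "S \<subseteq> carrier G"
    and symmetric: "S = (\<lambda>x. inv x) ` S"
    and generates: "generate G S = carrier G"
begin

lemma carrier_eq_set_powers: "carrier G = (\<Union>n. set_power G S n)"
  using generate_subset_set_powers[OF subset symmetric] set_power_closed[OF subset]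
  by (auto simp: generates)

lemma word_metric_le:
  assumes "g \<in> carrier G" "h \<in> carrier G" "inv g \<otimes> h \<in> set_power G S n"
  shows "word_metric G S g h \<le> real n"
  using assms by (auto simp: word_metric_def intro!: cInf_lower)

lemma word_metricE:
  assumes "g \<in> carrier G" "h \<in> carrier G"
  obtains n where "word_metric G S g h = real n" "inv g \<otimes> h \<in> set_power G S n"
proof -
  have "inv g \<otimes> h \<in> carrier G"
    using assms by simp
  then have "{n. inv g \<otimes> h \<in> set_power G S n} \<noteq> {}"
    using carrier_eq_set_powers by auto
  then have "Inf {n. inv g \<otimes> h \<in> set_power G S n} \<in> {n. inv g \<otimes> h \<in> set_power G S n}"
    by (rule Inf_nat_def1)
  then show thesis
    using that assms by (simp add: word_metric_def)
qed

lemma word_metric_commute_le: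
  assumes "g \<in> carrier G" "h \<in> carrier G"
  shows "word_metric G S h g \<le> word_metric G S g h"
proof -
  obtain n where n: "word_metric G S g h = real n" "inv g \<otimes> h \<in> set_power G S n"
    using word_metricE assms by blast
  have "inv h \<otimes> g = inv (inv g \<otimes> h)"
    using assms by (simp add: inv_mult_group)
  then have "inv h \<otimes> g \<in> set_power G S n"
    using inv_in_set_power[OF subset symmetric n(2)] by simp
  then show ?thesis
    using word_metric_le assms n by simp
qed

lemma Metric_space_word_metric: "Metric_space (carrier G) (word_metric G S)"
proof
  show nonneg: "0 \<le> word_metric G S g h" for g h
    by (simp add: word_metric_def)
  show "word_metric G S g h = word_metric G S h g" for g h
  proof (cases "g \<in> carrier G \<and> h \<in> carrier G")
    case True
    then show ?thesis
      using word_metric_commute_le by (meson order_antisym)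
  qed (auto simp: word_metric_def)
  fix g h assume gh: "g \<in> carrier G" "h \<in> carrier G"
  show "word_metric G S g h = 0 \<longleftrightarrow> g = h"
  proof
    assume 0: "word_metric G S g h = 0"
    obtain n where "word_metric G S g h = real n" "inv g \<otimes> h \<in> set_power G S n"
      using word_metricE gh by blast
    then have "inv g \<otimes> h = \<one>"
      using 0 by simp
    then show "g = h"
      using gh by (metis inv_equality inv_inv inv_closed)
  next
    assume "g = h"
    then have "word_metric G S g h \<le> real 0"
      using gh by (intro word_metric_le) auto
    then show "word_metric G S g h = 0"
      using nonneg[of g h] by simp
  qed
  fix k assume k: "k \<in> carrier G"
  obtain m where m: "word_metric G S g h = real m" "inv g \<otimes> h \<in> set_power G S m"
    using word_metricE gh by blast
  obtain n where n: "word_metric G S h k = real n" "inv h \<otimes> k \<in> set_power G S n"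
    using word_metricE gh k by blast
  have "inv g \<otimes> k = (inv g \<otimes> h) \<otimes> (inv h \<otimes> k)"
  proof -
    have "h \<otimes> (inv h \<otimes> k) = k"
      using gh k by (simp add: m_assoc[symmetric])
    then show ?thesis
      using gh k by (simp add: m_assoc)
  qed
  then have "inv g \<otimes> k \<in> set_power G S (m + n)"
    using mult_in_set_power_add[OF subset m(2) n(2)] by simp
  then show "word_metric G S g k \<le> word_metric G S g h + word_metric G S h k"
    using word_metric_le[OF gh(1) k] m n by force
qed

lemma word_metric_le_mult:
  assumes "symmetric_generating_set G S'"
    and S': "S' \<subseteq> (\<Union>k\<le>N. set_power G S k)" and gh: "g \<in> carrier G" "h \<in> carrier G"
  shows "word_metric G S g h \<le> real N * word_metric G S' g h"
proof -
  obtain n where n: "word_metric G S' g h = real n" "inv g \<otimes> h \<in> set_power G S' n"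
    using symmetric_generating_set.word_metricE[OF assms(1) gh] by blast
  then obtain k where k: "k \<le> N * n" "inv g \<otimes> h \<in> set_power G S k"
    using set_power_subset_balls[OF subset S'] by blast
  then have "word_metric G S g h \<le> real k"
    using word_metric_le gh by blast
  also have "\<dots> \<le> real (N * n)"
    using k by (simp only: of_nat_le_iff)
  finally show ?thesis
    using n by simp
qed

end


section \<open>Compact sets are bounded in word metrics\<close>

context topological_group
begin

lemma continuous_map_left_mult:
  assumes "g \<in> carrier G"
  shows "continuous_map T T (\<lambda>x. g \<otimes> x)"
proof -
  have "continuous_map T (prod_topology T T) (\<lambda>x. (g, x))"
    using assms by (intro continuous_map_pairedI) (auto simp: topspace_eq_carrier)
  then show ?thesis
    using continuous_map_compose[OF _ continuous_mult] by (force simp: o_def)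
qed

lemma compactin_set_power:
  assumes "compactin T S"
  shows "compactin T (set_power G S n)"
proof (induction n)
  case 0
  then show ?case
    by (simp add: topspace_eq_carrier)
next
  case (Suc n)
  then have "compactin (prod_topology T T) (set_power G S n \<times> S)"
    using assms by (simp add: compactin_Times)
  then have "compactin T ((\<lambda>(x, y). x \<otimes> y) ` (set_power G S n \<times> S))"
    using continuous_mult by (rule image_compactin)
  moreover have "(\<lambda>(x, y). x \<otimes> y) ` (set_power G S n \<times> S) = set_power G S (Suc n)"
    by (auto simp: set_mult_def)
  ultimately show ?case
    by simp
qed

text \<open>
  The carrier, being nonempty and open, is the interior of the union of the closed sets \<open>S\<^sup>n\<close>; by
  Baire's theorem these cannot all have empty interior.
\<close>

lemma set_power_has_interior:
  assumes "Hausdorff_space T" "locally_compact_space T"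
    and S: "compactin T S" and sym: "symmetric_generating_set G S"
  obtains n where "T interior_of (set_power G S n) \<noteq> {}"
proof -
  have "T interior_of \<Union>(range (set_power G S)) = carrier G"
    using symmetric_generating_set.carrier_eq_set_powers[OF sym]
    by (metis interior_of_topspace topspace_eq_carrier)
  then have "T interior_of \<Union>(range (set_power G S)) \<noteq> {}"
    by auto
  moreover have "locally_compact_space T \<and> regular_space T"
    using assms locally_compact_Hausdorff_imp_regular_space by blast
  moreover have "closedin T (set_power G S n)" for n
    using compactin_imp_closedin compactin_set_power assms by blast
  ultimately have "\<exists>n. T interior_of (set_power G S n) \<noteq> {}"
    using Baire_category_alt[of T "range (set_power G S)"] by auto
  then show thesis
    using that by blast
qed

text \<open>
  If \<open>V\<close> is the interior of \<open>S\<^sup>n\<close> and \<open>v \<in> V\<close>, then \<open>xv\<^sup>-\<^sup>1V\<close> is an open neighbourhood of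
  \<open>x\<close>. Finitely many translates \<open>gV\<close> therefore cover \<open>K\<close>, and every point of \<open>gV\<close> has word
  length at most \<open>n\<close> more than \<open>g\<close>.
\<close>

lemma compactin_subset_set_powers:
  assumes "Hausdorff_space T" "locally_compact_space T"
    and S: "compactin T S" and sym: "symmetric_generating_set G S" and K: "compactin T K"
  obtains N where "K \<subseteq> (\<Union>k\<le>N. set_power G S k)"
proof -
  interpret symmetric_generating_set G S
    by (rule sym)
  obtain n where "T interior_of (set_power G S n) \<noteq> {}"
    using set_power_has_interior assms by metis
  then obtain v where v: "v \<in> T interior_of (set_power G S n)"
    by blast
  define V where "V = T interior_of (set_power G S n)"
  have V: "openin T V" "V \<subseteq> set_power G S n" "v \<in> V" "v \<in> carrier G"
    using v openin_interior_of interior_of_subset interior_of_subset_topspace topspace_eq_carrier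
    unfolding V_def by fast+
  \<comment> \<open>\<open>W g\<close> is the translate \<open>gV\<close>, written as a preimage so that it is open by continuity alone.\<close>
  define W where "W = (\<lambda>g. {x \<in> topspace T. inv g \<otimes> x \<in> V})"
  have openW: "openin T (W g)" if "g \<in> carrier G" for g
    unfolding W_def using that
    by (intro openin_continuous_map_preimage[OF continuous_map_left_mult V(1)]) auto
  have Kc: "K \<subseteq> carrier G"
    using compactin_subset_topspace[OF K] topspace_eq_carrier by simp
  have "x \<in> W (x \<otimes> inv v)" if "x \<in> K" for x
    using that Kc V by (auto simp: W_def topspace_eq_carrier inv_mult_group m_assoc subset_iff)
  then have "K \<subseteq> \<Union>(W ` carrier G)"
    using Kc V by blast
  then obtain \<F> where "finite \<F>" "\<F> \<subseteq> W ` carrier G" "K \<subseteq> \<Union>\<F>"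
    using compactinD[OF K, of "W ` carrier G"] openW by blast
  then obtain F where F: "finite F" "F \<subseteq> carrier G" "K \<subseteq> \<Union>(W ` F)"
    by (metis finite_subset_image)
  have "\<forall>g\<in>F. \<exists>m. g \<in> set_power G S m"
    using F carrier_eq_set_powers by blast
  then obtain m where m: "\<And>g. g \<in> F \<Longrightarrow> g \<in> set_power G S (m g)"
    by metis
  have "K \<subseteq> (\<Union>k\<le>Max (m ` F) + n. set_power G S k)"
  proof
    fix x assume x: "x \<in> K"
    then obtain g where g: "g \<in> F" "inv g \<otimes> x \<in> V"
      using F(3) by (auto simp: W_def)
    have "g \<otimes> (inv g \<otimes> x) \<in> set_power G S (m g + n)"
      using mult_in_set_power_add[OF subset] m g V by blast
    moreover have "g \<otimes> (inv g \<otimes> x) = x"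
      using g F x Kc by (simp add: m_assoc[symmetric] subset_iff)
    moreover have "m g \<le> Max (m ` F)"
      using F g by simp
    ultimately show "x \<in> (\<Union>k\<le>Max (m ` F) + n. set_power G S k)"
      by auto
  qed
  then show thesis
    by (rule that)
qed

lemma word_metrics_bilipschitz:
  assumes "Hausdorff_space T" "locally_compact_space T"
    and S: "symmetric_compact_generating_set G T S"
    and S': "symmetric_compact_generating_set G T S'"
    and "p \<in> carrier G"
  obtains C where "bilipschitz_metrics (carrier G) (word_metric G S) (word_metric G S') p C"
proof -
  have gen: "symmetric_generating_set G S" "compactin T S"
    "symmetric_generating_set G S'" "compactin T S'"
    using S S' compactin_subset_topspace[of T] topspace_eq_carrier
    by (auto simp: symmetric_compact_generating_set_def symmetric_generating_set_def
        symmetric_generating_set_axioms_def)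
  obtain N where N: "S' \<subseteq> (\<Union>k\<le>N. set_power G S k)"
    using compactin_subset_set_powers[OF assms(1,2) gen(2,1,4)] .
  obtain N' where N': "S \<subseteq> (\<Union>k\<le>N'. set_power G S' k)"
    using compactin_subset_set_powers[OF assms(1,2) gen(4,3,2)] .
  \<comment> \<open>The successor keeps the constant positive when both generating sets have length bound \<open>0\<close>,
    as for the trivial group.\<close>
  define C where "C = real (Suc (max N N'))"
  interpret d: Metric_space "carrier G" "word_metric G S"
    by (rule symmetric_generating_set.Metric_space_word_metric[OF gen(1)])
  interpret d': Metric_space "carrier G" "word_metric G S'"
    by (rule symmetric_generating_set.Metric_space_word_metric[OF gen(3)])
  have "bilipschitz_metrics (carrier G) (word_metric G S) (word_metric G S') p C"
  proof unfold_locales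
    show "p \<in> carrier G" "0 < C"
      using assms by (auto simp: C_def)
    fix x y assume xy: "x \<in> carrier G" "y \<in> carrier G"
    have "real N * word_metric G S' x y \<le> C * word_metric G S' x y"
      by (intro mult_right_mono) (auto simp: C_def)
    then show "word_metric G S x y \<le> C * word_metric G S' x y"
      using symmetric_generating_set.word_metric_le_mult[OF gen(1,3) N xy] by simp
    have "real N' * word_metric G S x y \<le> C * word_metric G S x y"
      by (intro mult_right_mono) (auto simp: C_def)
    then show "word_metric G S' x y \<le> C * word_metric G S x y"
      using symmetric_generating_set.word_metric_le_mult[OF gen(3,1) N' xy] by simp
  qed
  then show thesis
    by (rule that)
qed

end


section \<open>Independence of the boundaries\<close>

theorem lemma5p3:
  fixes G :: "('a, 'b) monoid_scheme" and T :: "'a topology" and S S' :: "'a set" and p :: 'a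
  assumes "topological_group G T"
    and "Hausdorff_space T"
    and "locally_compact_space T"
    and "compactly_generated G T"
    and "symmetric_compact_generating_set G T S"
    and "symmetric_compact_generating_set G T S'"
    and "p \<in> carrier G"
  shows "linear_boundary G (word_metric G S) p = linear_boundary G (word_metric G S') p
    \<and> projective_boundary G (word_metric G S) p = projective_boundary G (word_metric G S') p"
proof -
  obtain C where "bilipschitz_metrics (carrier G) (word_metric G S) (word_metric G S') p C"
    using topological_group.word_metrics_bilipschitz[OF assms(1,2,3,5,6,7)] .
  then interpret bilipschitz_metrics "carrier G" "word_metric G S" "word_metric G S'" p C .
  show ?thesis
    by (simp add: linear_boundary_def projective_boundary_def boundary_space_eq unbounded_sets_eq)
qed

end
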